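(* Let $\mathcal{H}_1,\mathcal{H}_2$ be Hilbert spaces over $\mathbb{F}=\mathbb{R}$ or $\mathbb{F}=\mathbb{C}$, let $K$ be a positive integer, and let $\{A_k\}_{k=1}^{K}\subset \mathcal{BC}(\mathcal{H}_1,\mathcal{H}_2)$. Assume that $\mathrm{R}(A_k)\subseteq \mathrm{N}(A_{k'}^{*})$ and $\mathrm{R}(A_k^{*})\subseteq \mathrm{N}(A_{k'})$ for each $k,k'=1,\ldots,K$, $k\neq k'$. Then: (i) $A_kA_{k'}^{\dagger}=0$ and $A_k^{\dagger}A_{k'}=0$ for each $k,k'=1,\ldots,K$, $k\neq k'$. (ii) $\mathrm{R}\left(\sum_{k=1}^{K}A_k\right)=\bigoplus_{k=1}^{K}\mathrm{R}(A_k)$ and $\mathrm{R}\left(\sum_{k=1}^{K}A_k^{*}\right)=\bigoplus_{k=1}^{K}\mathrm{R}(A_k^{*})$. (iii) $\mathrm{N}\left(\sum_{k=1}^{K}A_k\right)=\bigcap_{k=1}^{K}\mathrm{N}(A_k)$ and $\mathrm{N}\left(\sum_{k=1}^{K}A_k^{*}\right)=\bigcap_{k=1}^{K}\mathrm{N}(A_k^{*})$. (iv) $\left(\sum_{k=1}^{K}A_k\right)^{\dagger}$ exists and $\left(\sum_{k=1}^{K}A_k\right)^{\dagger}=\sum_{k=1}^{K}A_k^{\dagger}$.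
   Context: $\mathcal{BC}(\mathcal{H}_1,\mathcal{H}_2)$ is the set of bounded linear operators from $\mathcal{H}_1$ to $\mathcal{H}_2$ with closed range. $A^{*}$, $\mathrm{N}(A)$, $\mathrm{R}(A)$ denote the adjoint, null space and range of $A$. $\oplus$ denotes orthogonal (direct) sum of mutually orthogonal subspaces. For $A\in\mathcal{BC}(\mathcal{H}_1,\mathcal{H}_2)$, the Moore--Penrose inverse $A^{\dagger}\in\mathcal{BC}(\mathcal{H}_2,\mathcal{H}_1)$ is the unique solution $X$ of $AXA=A$, $XAX=X$, $(AX)^{*}=AX$, $(XA)^{*}=XA$. A bounded operator has a Moore--Penrose inverse if and only if its range is closed. *)

theory Defs
  imports "HOL-Analysis.Analysis"
begin

(* The scalar field: real or complex.  A real normed field is isomorphic to one of these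
   by Gelfand-Mazur, and the last axiom then determines conjg. *)
class real_or_complex = real_normed_field +
  fixes conjg :: "'a \<Rightarrow> 'a"
  assumes conjg_add: "conjg (x + y) = conjg x + conjg y"
    and conjg_mult: "conjg (x * y) = conjg x * conjg y"
    and mult_conj: "x * conjg x = (norm x)\<^sup>2 *\<^sub>R 1"

instantiation real :: real_or_complex
begin
definition conjg_real :: "real \<Rightarrow> real" where "conjg_real x = x"
instance by standard (auto simp: conjg_real_def power2_eq_square)
end

instantiation complex :: real_or_complex
begin
definition conjg_complex :: "complex \<Rightarrow> complex" where "conjg_complex = cnj"
instance by standard (simp_all add: conjg_complex_def scaleR_conv_of_real complex_norm_square del: of_real_power)
end

(* Completeness and the norm topology come from the class banach; the axioms tie its norm
   and its real scaling to the inner product and to the scalar multiplication over 'k. *)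
locale hilbert_space = vector_space scale
  for scale :: "'k::real_or_complex \<Rightarrow> 'a::banach \<Rightarrow> 'a" +
  fixes ip :: "'a \<Rightarrow> 'a \<Rightarrow> 'k"
  assumes scale_of_real: "scale (of_real r) x = r *\<^sub>R x"
    and ip_add_left: "ip (x + y) z = ip x z + ip y z"
    and ip_scale_left: "ip (scale c x) y = c * ip x y"
    and ip_commute: "ip y x = conjg (ip x y)"
    and ip_norm: "ip x x = of_real ((norm x)\<^sup>2)"

lemma hilbert_space_real_inner:
  "hilbert_space (scaleR :: real \<Rightarrow> 'a::{real_inner, banach} \<Rightarrow> 'a) inner"
  by (intro hilbert_space.intro hilbert_space_axioms.intro vector_space.intro)
    (simp_all add: scaleR_add_right scaleR_add_left inner_add_left conjg_real_def
       power2_norm_eq_inner, simp add: inner_commute)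

lemma hilbert_space_complex:
  "hilbert_space ((*) :: complex \<Rightarrow> complex \<Rightarrow> complex) (\<lambda>x y. x * cnj y)"
  by (intro hilbert_space.intro hilbert_space_axioms.intro vector_space.intro)
    (simp_all add: distrib_left distrib_right scaleR_conv_of_real conjg_complex_def
       complex_norm_square del: of_real_power)

definition null_space :: "('a::real_normed_vector \<Rightarrow>\<^sub>L 'b::real_normed_vector) \<Rightarrow> 'a set" where
  "null_space A = {x. blinfun_apply A x = 0}"

definition range_space :: "('a::real_normed_vector \<Rightarrow>\<^sub>L 'b::real_normed_vector) \<Rightarrow> 'b set" where
  "range_space A = range (blinfun_apply A)"

(* A value of type 'a =>_L 'b is bounded but only real-linear; linearity over 'k is
   imposed separately. *)
definition BC :: "('k::real_or_complex \<Rightarrow> 'a::banach \<Rightarrow> 'a) \<Rightarrow> ('k \<Rightarrow> 'b::banach \<Rightarrow> 'b)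
    \<Rightarrow> ('a \<Rightarrow>\<^sub>L 'b) set" where
  "BC s1 s2 = {A. Vector_Spaces.linear s1 s2 (blinfun_apply A) \<and> closed (range_space A)}"

definition hilbert_adjoint :: "('a::banach \<Rightarrow> 'a \<Rightarrow> 'k::real_or_complex) \<Rightarrow> ('b::banach \<Rightarrow> 'b \<Rightarrow> 'k)
    \<Rightarrow> ('a \<Rightarrow>\<^sub>L 'b) \<Rightarrow> ('b \<Rightarrow>\<^sub>L 'a)" where
  "hilbert_adjoint ip1 ip2 A =
     (THE B. \<forall>x y. ip2 (blinfun_apply A x) y = ip1 x (blinfun_apply B y))"

definition is_moore_penrose ::
  "('k::real_or_complex \<Rightarrow> 'a::banach \<Rightarrow> 'a) \<Rightarrow> ('a \<Rightarrow> 'a \<Rightarrow> 'k)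
    \<Rightarrow> ('k \<Rightarrow> 'b::banach \<Rightarrow> 'b) \<Rightarrow> ('b \<Rightarrow> 'b \<Rightarrow> 'k)
    \<Rightarrow> ('a \<Rightarrow>\<^sub>L 'b) \<Rightarrow> ('b \<Rightarrow>\<^sub>L 'a) \<Rightarrow> bool" where
  "is_moore_penrose s1 ip1 s2 ip2 A X \<longleftrightarrow>
     X \<in> BC s2 s1 \<and>
     A o\<^sub>L X o\<^sub>L A = A \<and>
     X o\<^sub>L A o\<^sub>L X = X \<and>
     hilbert_adjoint ip2 ip2 (A o\<^sub>L X) = A o\<^sub>L X \<and>
     hilbert_adjoint ip1 ip1 (X o\<^sub>L A) = X o\<^sub>L A"

definition moore_penrose ::
  "('k::real_or_complex \<Rightarrow> 'a::banach \<Rightarrow> 'a) \<Rightarrow> ('a \<Rightarrow> 'a \<Rightarrow> 'k)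
    \<Rightarrow> ('k \<Rightarrow> 'b::banach \<Rightarrow> 'b) \<Rightarrow> ('b \<Rightarrow> 'b \<Rightarrow> 'k)
    \<Rightarrow> ('a \<Rightarrow>\<^sub>L 'b) \<Rightarrow> ('b \<Rightarrow>\<^sub>L 'a)" where
  "moore_penrose s1 ip1 s2 ip2 A = (THE X. is_moore_penrose s1 ip1 s2 ip2 A X)"

(* S is the orthogonal direct sum of the V k, k in I.  Uniqueness of the decomposition
   follows from mutual orthogonality. *)
definition is_orthogonal_sum ::
  "('k::real_or_complex \<Rightarrow> 'a::banach \<Rightarrow> 'a) \<Rightarrow> ('a \<Rightarrow> 'a \<Rightarrow> 'k)
    \<Rightarrow> 'i set \<Rightarrow> ('i \<Rightarrow> 'a set) \<Rightarrow> 'a set \<Rightarrow> bool" where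
  "is_orthogonal_sum s ip I V S \<longleftrightarrow>
     (\<forall>k\<in>I. module.subspace s (V k)) \<and>
     (\<forall>k\<in>I. \<forall>l\<in>I. k \<noteq> l \<longrightarrow> (\<forall>x\<in>V k. \<forall>y\<in>V l. ip x y = 0)) \<and>
     S = {\<Sum>k\<in>I. v k | v. \<forall>k\<in>I. v k \<in> V k}"

end

theory Submission imports Defs begin

text \<open>Riesz representation gives adjoints; uniform boundedness, applied to functionals indexed by the
  range of \<open>A\<close>, shows that \<open>A\<^sup>*\<close> is bounded below on a closed range of \<open>A\<close>, so \<open>R(A\<^sup>*)\<close> is
  closed as well and \<open>A\<close> is bounded below on it.  Solving the normal equations \<open>A\<^sup>* A x = A\<^sup>* y\<close>
  inside \<open>R(A\<^sup>*)\<close> then yields the Moore-Penrose inverse.  Since \<open>R(A\<^sup>\<dagger>) \<subseteq> R(A\<^sup>*)\<close> and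
  \<open>N(A\<^sup>*) \<subseteq> N(A\<^sup>\<dagger>)\<close>, the hypotheses make all mixed products of \<open>A\<^sub>k\<close> and \<open>A\<^sub>l\<^sup>\<dagger>\<close>
  vanish, and the Penrose equations for the sums split into those of the summands.\<close>

subsection \<open>Hilbert spaces over the scalar field\<close>

lemma conjg_0 [simp]: "conjg 0 = (0::'k::real_or_complex)"
  using conjg_add[of 0 "0::'k"] by simp

text \<open>Taking norms in \<open>mult_conj\<close> gives
  \<open>norm x * norm (conjg x) = norm x * norm x\<close>, and \<open>norm x\<close>
  cancels.\<close>

lemma norm_conjg [simp]: "norm (conjg x) = norm (x::'k::real_or_complex)"
proof (cases "x = 0")
  case False
  have "norm x * norm (conjg x) = norm x * norm x"
    using arg_cong[OF mult_conj[of x], of norm] by (simp add: norm_mult power2_eq_square)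
  with False show ?thesis by simp
qed simp

text \<open>By \<open>norm_conjg\<close>, \<open>mult_conj\<close> has the same right-hand side for
  \<open>x\<close> and for \<open>conjg x\<close>; then \<open>conjg x\<close> cancels.\<close>

lemma conjg_conjg [simp]: "conjg (conjg x) = (x::'k::real_or_complex)"
proof (cases "x = 0")
  case False
  then have nz: "conjg x \<noteq> 0" by (metis norm_conjg norm_eq_zero)
  have "conjg x * conjg (conjg x) = conjg x * x"
    using mult_conj[of x] mult_conj[of "conjg x"] by (simp add: mult.commute)
  with nz show ?thesis by simp
qed simp

lemma conjg_of_real [simp]: "conjg (of_real r) = (of_real r :: 'k::real_or_complex)"
proof (cases "r = 0")
  case False
  have "of_real r * conjg (of_real r) = (of_real r * of_real r :: 'k)"
    using mult_conj[of "of_real r :: 'k"]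
    by (simp add: scaleR_conv_of_real power2_eq_square)
  with False show ?thesis by simp
qed simp

section \<open>Inner product algebra and the Cauchy-Schwarz inequality\<close>

context hilbert_space
begin

lemma ip_add_right: "ip x (y + z) = ip x y + ip x z"
  by (metis ip_add_left ip_commute conjg_add)

lemma ip_scale_right: "ip x (scale c y) = conjg c * ip x y"
  by (metis ip_scale_left ip_commute conjg_mult)

lemma ip_zero_left [simp]: "ip 0 x = 0"
  using ip_add_left[of 0 0 x] by simp

lemma ip_zero_right [simp]: "ip x 0 = 0"
  using ip_add_right[of x 0 0] by simp

lemma ip_diff_left: "ip (x - y) z = ip x z - ip y z"
  using ip_add_left[of "x - y" y z] by (simp add: algebra_simps)

lemma ip_diff_right: "ip z (x - y) = ip z x - ip z y"
  using ip_add_right[of z "x - y" y] by (simp add: algebra_simps)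

lemma ip_scaleR_left: "ip (r *\<^sub>R x) y = r *\<^sub>R ip x y"
  using ip_scale_left[of "of_real r" x y] by (simp add: scale_of_real scaleR_conv_of_real)

lemma ip_sum_left: "ip (sum f I) x = (\<Sum>i\<in>I. ip (f i) x)"
  by (induction I rule: infinite_finite_induct) (auto simp: ip_add_left)

lemma ip_sum_right: "ip x (sum f I) = (\<Sum>i\<in>I. ip x (f i))"
  by (induction I rule: infinite_finite_induct) (auto simp: ip_add_right)

lemma ip_self_eq_0 [simp]: "ip x x = 0 \<longleftrightarrow> x = 0"
  by (simp add: ip_norm del: of_real_power)

lemma ip_eq_0_commute: "ip x y = 0 \<longleftrightarrow> ip y x = 0"
  by (metis ip_commute conjg_0)

lemma ip_eqI: "(\<And>z. ip x z = ip y z) \<Longrightarrow> x = y"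
  by (metis ip_diff_left ip_self_eq_0 right_minus_eq)

lemma ip_eqI': "(\<And>z. ip z x = ip z y) \<Longrightarrow> x = y"
  by (metis ip_commute ip_eqI)

text \<open>Lets a norm identity be computed in the field \<open>'k\<close> and read back over the
  reals.\<close>

lemma norm_eq_from_ip: "ip x x = of_real r \<Longrightarrow> (norm x)\<^sup>2 = r"
  by (metis ip_norm of_real_eq_iff)

text \<open>Pythagoras for the component of \<open>x\<close> orthogonal to \<open>y\<close>. It
  yields Cauchy-Schwarz and, later, the orthogonality of a best approximation.\<close>

lemma norm_sq_diff_scale:
  "(norm (x - scale (ip x y / ip y y) y))\<^sup>2 = (norm x)\<^sup>2 - (norm (ip x y))\<^sup>2 / (norm y)\<^sup>2"
proof (rule norm_eq_from_ip)
  let ?a = "ip x y" and ?n = "(norm y)\<^sup>2"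
  have a: "?a * conjg ?a = of_real ((norm ?a)\<^sup>2)"
    using mult_conj[of ?a] by (simp add: scaleR_conv_of_real)
  have yx: "ip y x = conjg ?a" by (rule ip_commute)
  have c: "conjg (?a / of_real ?n) = conjg ?a / of_real ?n"
    using conjg_mult[of ?a "of_real (1 / ?n)"] conjg_of_real[of "1 / ?n", where 'k='k]
    by (simp add: field_simps)
  show "ip (x - scale (?a / ip y y) y) (x - scale (?a / ip y y) y)
      = of_real ((norm x)\<^sup>2 - (norm ?a)\<^sup>2 / ?n)"
  \<comment> \<open>For \<open>y = 0\<close> division by zero returns 0, so both correction terms
    vanish.\<close>
  proof (cases "y = 0")
    case False
    then have nz: "(of_real ?n :: 'k) \<noteq> 0" by simp
    have "ip (x - scale (?a / ip y y) y) (x - scale (?a / ip y y) y)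
      = ip x x - ?a / of_real ?n * conjg ?a - (conjg ?a / of_real ?n * ?a
         - conjg ?a / of_real ?n * (?a / of_real ?n * of_real ?n))"
      by (simp only: ip_diff_left ip_diff_right ip_scale_left ip_scale_right c yx ip_norm[of y]
          right_diff_distrib)
    also have "\<dots> = ip x x - (?a * conjg ?a) / of_real ?n"
      using nz by (simp add: field_simps del: of_real_power)
    finally show ?thesis by (simp only: a ip_norm of_real_diff of_real_divide)
  qed (simp add: ip_norm)
qed

text \<open>The squared norm in \<open>norm_sq_diff_scale\<close> is nonnegative.\<close>

lemma Cauchy_Schwarz: "norm (ip x y) \<le> norm x * norm y"
proof (cases "y = 0")
  case False
  have "0 \<le> (norm x)\<^sup>2 - (norm (ip x y))\<^sup>2 / (norm y)\<^sup>2"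
    by (metis norm_sq_diff_scale zero_le_power2)
  then have "(norm (ip x y))\<^sup>2 \<le> (norm x * norm y)\<^sup>2"
    using False by (simp add: field_simps)
  then show ?thesis by (rule power2_le_imp_le) simp
qed simp

lemma bounded_linear_ip_left: "bounded_linear (\<lambda>x. ip x y)"
  by (rule bounded_linear_intro[of _ "norm y"]) (auto simp: ip_add_left ip_scaleR_left Cauchy_Schwarz)

lemma parallelogram:
  fixes x y :: 'a
  shows "(norm (x + y))\<^sup>2 + (norm (x - y))\<^sup>2 = 2 * (norm x)\<^sup>2 + 2 * (norm y)\<^sup>2"
proof -
  have "ip (x + y) (x + y) + ip (x - y) (x - y) = of_real 2 * ip x x + of_real 2 * ip y y"
    by (simp add: ip_add_left ip_add_right ip_diff_left ip_diff_right)
  then show ?thesis by (simp only: ip_norm of_real_add[symmetric] of_real_mult[symmetric] of_real_eq_iff)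
qed

section \<open>Orthogonal projection onto closed subspaces and Riesz representation\<close>

lemma subspace_scaleR: "subspace S \<Longrightarrow> x \<in> S \<Longrightarrow> r *\<^sub>R x \<in> S"
  by (metis scale_of_real subspace_scale)

text \<open>A sequence in \<open>S\<close> minimising the distance to \<open>x\<close> is Cauchy by
  the parallelogram law; its limit is a best approximation, and the error of a best approximation is
  orthogonal to \<open>S\<close>.\<close>

lemma orthogonal_decomposition:
  assumes S: "subspace S" "closed S"
  obtains p where "p \<in> S" "\<And>y. y \<in> S \<Longrightarrow> ip (x - p) y = 0"
proof -
  define d where "d = infdist x S"
  have ne: "S \<noteq> {}" using subspace_0[OF S(1)] by auto
  have d0: "0 \<le> d" by (simp add: d_def infdist_nonneg)
  have dle: "d \<le> norm (x - y)" if "y \<in> S" for y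
    using infdist_le[OF that, of x] by (simp add: d_def dist_norm)
  have "\<exists>y\<in>S. (norm (x - y))\<^sup>2 < d\<^sup>2 + inverse (real (Suc n))" for n
  proof (rule ccontr)
    assume "\<not> ?thesis"
    then have "sqrt (d\<^sup>2 + inverse (real (Suc n))) \<le> dist x y" if "y \<in> S" for y
      using that by (auto simp: dist_norm not_less intro!: real_le_lsqrt)
    then have "sqrt (d\<^sup>2 + inverse (real (Suc n))) \<le> d"
      unfolding d_def infdist_notempty[OF ne] by (intro cINF_greatest ne)
    with d0 have "d\<^sup>2 + inverse (real (Suc n)) \<le> d\<^sup>2"
      using sqrt_le_D by blast
    then show False by simp
  qed
  then obtain p where pS: "\<And>n. p n \<in> S"
    and p: "\<And>n. (norm (x - p n))\<^sup>2 < d\<^sup>2 + inverse (real (Suc n))" by metis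
  \<comment> \<open>The midpoint of \<open>p m\<close> and \<open>p n\<close> lies in
    \<open>S\<close>, so the sum of the two errors has norm at least \<open>2 * d\<close>; the
    parallelogram law leaves only the excesses over \<open>d^2\<close> for their difference.\<close>
  have close: "(norm (p m - p n))\<^sup>2 \<le> 2 * inverse (real (Suc m)) + 2 * inverse (real (Suc n))" for m n
  proof -
    have "(1/2) *\<^sub>R (p m + p n) \<in> S"
      by (intro subspace_scaleR subspace_add pS S)
    then have "d \<le> norm (x - (1/2) *\<^sub>R (p m + p n))" by (rule dle)
    moreover have "x - p m + (x - p n) = 2 *\<^sub>R (x - (1/2) *\<^sub>R (p m + p n))"
      by (simp add: algebra_simps scaleR_2)
    ultimately have "2 * d \<le> norm (x - p m + (x - p n))" by simp
    then have "(2 * d)\<^sup>2 \<le> (norm (x - p m + (x - p n)))\<^sup>2"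
      using d0 by (intro power_mono) auto
    moreover have "norm (x - p m - (x - p n)) = norm (p m - p n)"
      by (simp add: norm_minus_commute)
    ultimately show ?thesis
      using parallelogram[of "x - p m" "x - p n"] p[of m] p[of n] by (simp add: power_mult_distrib)
  qed
  have "Cauchy p"
    unfolding Cauchy_altdef
  proof (intro allI impI)
    fix e :: real assume "0 < e"
    \<comment> \<open>The two terms of \<open>close\<close> add up to at most four times
      \<open>inverse (real (Suc M))\<close>, hence the quarter.\<close>
    then obtain M where M: "inverse (real (Suc M)) < e\<^sup>2 / 4"
      using reals_Archimedean[of "e\<^sup>2 / 4"] by auto
    have "dist (p m) (p n) < e" if "m \<ge> M" "n > m" for m n
    proof -
      have "inverse (real (Suc m)) \<le> inverse (real (Suc M))" "inverse (real (Suc n)) \<le> inverse (real (Suc M))"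
        using that by (auto intro!: le_imp_inverse_le)
      with close[of m n] M have "(norm (p m - p n))\<^sup>2 < e\<^sup>2" by linarith
      then show ?thesis
        using \<open>0 < e\<close> by (simp add: dist_norm power_less_imp_less_base)
    qed
    then show "\<exists>M. \<forall>m\<ge>M. \<forall>n>m. dist (p m) (p n) < e" by blast
  qed
  then obtain q where q: "p \<longlonglongrightarrow> q" using Cauchy_convergent convergentD by blast
  have qS: "q \<in> S" using closed_sequentially[OF S(2) _ q] pS by blast
  have "(\<lambda>n. (norm (x - p n))\<^sup>2) \<longlonglongrightarrow> (norm (x - q))\<^sup>2" by (intro tendsto_intros q)
  moreover have "(\<lambda>n. d\<^sup>2 + inverse (real (Suc n))) \<longlonglongrightarrow> d\<^sup>2 + 0"
    by (intro tendsto_intros LIMSEQ_inverse_real_of_nat)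
  ultimately have qd: "(norm (x - q))\<^sup>2 \<le> d\<^sup>2"
    using p by (intro LIMSEQ_le[of _ _ "\<lambda>n. d\<^sup>2 + inverse (real (Suc n))"]) (auto intro: less_imp_le)
  have "ip (x - q) y = 0" if y: "y \<in> S" for y
  proof (cases "y = 0")
    case False
    \<comment> \<open>Moving from \<open>q\<close> by \<open>?c\<close> times \<open>y\<close> stays
      in \<open>S\<close> and lowers the squared distance by the term in
      \<open>norm_sq_diff_scale\<close>, which must therefore be 0.\<close>
    let ?c = "ip (x - q) y / ip y y"
    have "q + scale ?c y \<in> S" using S(1) qS y by (intro subspace_add subspace_scale)
    then have "d\<^sup>2 \<le> (norm (x - (q + scale ?c y)))\<^sup>2" using dle d0 by (intro power_mono) auto
    also have "x - (q + scale ?c y) = (x - q) - scale ?c y" by simp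
    finally have "(norm (ip (x - q) y))\<^sup>2 / (norm y)\<^sup>2 \<le> 0"
      using qd unfolding norm_sq_diff_scale by simp
    with False show ?thesis by (auto simp: divide_le_0_iff)
  qed simp
  from that[OF qS this] show ?thesis .
qed

text \<open>Take \<open>z\<close> orthogonal to the kernel of \<open>f\<close> with
  \<open>f z\<close> nonzero. The vector \<open>scale (f x) z - scale (f z) x\<close> lies in the
  kernel, and pairing it with \<open>z\<close> shows that \<open>f x\<close> is a fixed multiple of
  \<open>ip x z\<close>.\<close>

lemma Riesz_representation:
  assumes f: "bounded_linear f" and fs: "\<And>c x. f (scale c x) = c * f x"
  obtains y where "\<And>x. f x = ip x y"
proof (cases "\<forall>x. f x = 0")
  case True
  then show ?thesis using that[of 0] by simp
next
  case False
  interpret f: bounded_linear f by fact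
  obtain x0 where x0: "f x0 \<noteq> 0" using False by auto
  let ?N = "{x. f x = 0}"
  have "subspace ?N" by (auto simp: subspace_def f.add fs f.zero)
  moreover have "closed ?N"
    by (intro closed_Collect_eq continuous_intros linear_continuous_on f)
  ultimately obtain p where "p \<in> ?N" "\<And>y. y \<in> ?N \<Longrightarrow> ip (x0 - p) y = 0"
    using orthogonal_decomposition[of ?N x0] by blast
  then have p: "f p = 0" "\<And>y. f y = 0 \<Longrightarrow> ip (x0 - p) y = 0" by auto
  define z where "z = x0 - p"
  have fz: "f z \<noteq> 0" using x0 p by (simp add: z_def f.diff)
  then have zz: "ip z z \<noteq> 0" by (metis f.zero ip_self_eq_0)
  show ?thesis
  proof (rule that[of "scale (conjg (f z / ip z z)) z"])
    fix x
    have "f (scale (f x) z - scale (f z) x) = 0" by (simp add: f.diff fs)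
    from p(2)[OF this] have "ip (scale (f x) z - scale (f z) x) z = 0"
      using ip_eq_0_commute z_def by blast
    then have "f x * ip z z = f z * ip x z" by (simp add: ip_diff_left ip_scale_left)
    then show "f x = ip x (scale (conjg (f z / ip z z)) z)"
      using zz by (simp add: ip_scale_right field_simps)
  qed
qed

end

text \<open>By Baire, one of the closed sets \<open>E n\<close> of points where \<open>F\<close> is
  bounded by \<open>n\<close> contains a ball; differences of points of this ball give a bound near
  the origin.\<close>

theorem uniform_boundedness:
  fixes F :: "('a::banach \<Rightarrow>\<^sub>L 'c::real_normed_vector) set"
  assumes pw: "\<And>x. \<exists>M. \<forall>T\<in>F. norm (blinfun_apply T x) \<le> M"
  shows "\<exists>M\<ge>0. \<forall>T\<in>F. norm T \<le> M"
proof -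
  define E where "E n = {x. \<forall>T\<in>F. norm (blinfun_apply T x) \<le> real n}" for n :: nat
  have "closed (E n)" for n
  proof -
    have "E n = (\<Inter>T\<in>F. {x. norm (blinfun_apply T x) \<le> real n})" by (auto simp: E_def)
    also have "closed \<dots>"
      by (intro closed_INT ballI closed_Collect_le continuous_intros)
    finally show ?thesis .
  qed
  have "\<Union>(range E) = UNIV"
  proof -
    have "\<exists>n. x \<in> E n" for x
    proof -
      obtain M where M: "\<forall>T\<in>F. norm (blinfun_apply T x) \<le> M" using pw by blast
      obtain n :: nat where "M \<le> real n" using real_arch_simple by blast
      with M have "x \<in> E n" unfolding E_def by force
      then show ?thesis ..
    qed
    then show ?thesis by auto
  qed
  have "\<exists>n. interior (E n) \<noteq> {}"
  proof (rule ccontr)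
    assume "\<not> ?thesis"
    then have "interior (\<Union>(range E)) = {}"
      using Baire_category_alt[of "euclidean :: 'a topology" "range E"] \<open>\<And>n. closed (E n)\<close>
      by (simp add: completely_metrizable_space_euclidean image_iff) blast
    with \<open>\<Union>(range E) = UNIV\<close> show False by simp
  qed
  then obtain n where "interior (E n) \<noteq> {}" ..
  then obtain x r where r: "r > 0" "ball x r \<subseteq> E n"
    by (metis all_not_in_conv mem_interior)
  have "norm T \<le> 4 * real n / r" if T: "T \<in> F" for T
  proof (rule norm_blinfun_bound)
    fix u
    show "norm (blinfun_apply T u) \<le> 4 * real n / r * norm u"
    proof (cases "u = 0")
      case False
      \<comment> \<open>\<open>v\<close> is \<open>u\<close> rescaled to length
        \<open>r / 2\<close>, so that \<open>x + v\<close> stays in the ball. The bound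
        \<open>2 * real n\<close> at \<open>v\<close> becomes \<open>4 * real n / r\<close> after
        undoing the scaling.\<close>
      define v where "v = (r / (2 * norm u)) *\<^sub>R u"
      have "norm v < r" using r False by (simp add: v_def)
      then have "x + v \<in> E n" "x \<in> E n" using r by (auto simp: subset_iff dist_norm)
      then have "norm (blinfun_apply T (x + v)) \<le> real n" "norm (blinfun_apply T x) \<le> real n"
        using T by (auto simp: E_def)
      then have "norm (blinfun_apply T v) \<le> 2 * real n"
        using norm_triangle_ineq4[of "blinfun_apply T (x + v)" "blinfun_apply T x"]
        by (simp add: blinfun.add_right)
      then show ?thesis using r False by (simp add: v_def blinfun.scaleR_right field_simps)
    qed simp
  qed (use r in simp)
  with r show ?thesis by (intro exI[of _ "4 * real n / r"]) auto
qed

subsection \<open>Adjoints and Moore-Penrose inverses\<close>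

text \<open>In the double sum only the diagonal terms survive.\<close>

lemma blinfun_sum_apply_sum:
  assumes "finite I"
    and "\<And>k l. \<lbrakk>k \<in> I; l \<in> I; k \<noteq> l\<rbrakk> \<Longrightarrow> blinfun_apply (f l) (u k) = 0"
  shows "blinfun_apply (sum f I) (sum u I) = (\<Sum>k\<in>I. blinfun_apply (f k) (u k))"
proof -
  have "blinfun_apply (sum f I) (sum u I)
      = (\<Sum>l\<in>I. \<Sum>k\<in>I. if k = l then blinfun_apply (f l) (u l) else 0)"
    unfolding blinfun.sum_left blinfun.sum_right using assms(2) by (intro sum.cong) auto
  with assms(1) show ?thesis by simp
qed

section \<open>Linear operators between two Hilbert spaces, their adjoints and their sums\<close>

locale hilbert_pair =
  H1: hilbert_space s1 ip1 + H2: hilbert_space s2 ip2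
  for s1 :: "'k::real_or_complex \<Rightarrow> 'a::banach \<Rightarrow> 'a" and ip1 :: "'a \<Rightarrow> 'a \<Rightarrow> 'k"
    and s2 :: "'k \<Rightarrow> 'b::banach \<Rightarrow> 'b" and ip2 :: "'b \<Rightarrow> 'b \<Rightarrow> 'k"
begin

abbreviation linear_op :: "('a \<Rightarrow>\<^sub>L 'b) \<Rightarrow> bool" where
  "linear_op A \<equiv> Vector_Spaces.linear s1 s2 (blinfun_apply A)"

abbreviation adj :: "('a \<Rightarrow>\<^sub>L 'b) \<Rightarrow> ('b \<Rightarrow>\<^sub>L 'a)" where
  "adj \<equiv> hilbert_adjoint ip1 ip2"

lemma linear_op_scale: "linear_op A \<Longrightarrow> blinfun_apply A (s1 c x) = s2 c (blinfun_apply A x)"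
  by (simp add: Vector_Spaces.linear_iff)

lemma linear_opI: "(\<And>c x. blinfun_apply A (s1 c x) = s2 c (blinfun_apply A x)) \<Longrightarrow> linear_op A"
  by (simp add: Vector_Spaces.linear_iff H1.vector_space_axioms H2.vector_space_axioms blinfun.add_right)

lemma linear_op_sum: "(\<And>i. i \<in> I \<Longrightarrow> linear_op (f i)) \<Longrightarrow> linear_op (sum f I)"
  by (rule linear_opI) (simp add: blinfun.sum_left linear_op_scale H2.scale_sum_right)

lemma range_subspace: "linear_op A \<Longrightarrow> H2.subspace (range_space A)"
  by (simp add: range_space_def module_hom.subspace_image H1.subspace_UNIV linear_iff_module_hom)

lemma adjoint_eqI:
  assumes "\<And>x y. ip2 (blinfun_apply A x) y = ip1 x (blinfun_apply B y)"
  shows "adj A = B"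
  unfolding hilbert_adjoint_def
proof (rule the_equality)
  fix C assume "\<forall>x y. ip2 (blinfun_apply A x) y = ip1 x (blinfun_apply C y)"
  with assms show "C = B" by (intro blinfun_eqI H1.ip_eqI') simp
qed (use assms in blast)

text \<open>The definite description \<open>adj A\<close> has a value once a bounded operator
  satisfies the identity. Riesz supplies its values \<open>g y\<close>; linearity of
  \<open>g\<close> follows by testing against all vectors, and the bound from Cauchy-Schwarz for
  \<open>ip2 (A (g y)) y\<close>.\<close>

lemma adjoint_apply:
  assumes A: "linear_op A"
  shows "ip2 (blinfun_apply A x) y = ip1 x (blinfun_apply (adj A) y)"
proof -
  have "\<exists>z. \<forall>x. ip2 (blinfun_apply A x) y = ip1 x z" for y
  proof -
    have "bounded_linear (\<lambda>x. ip2 (blinfun_apply A x) y)"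
      by (rule bounded_linear_compose[OF H2.bounded_linear_ip_left blinfun.bounded_linear_right])
    moreover have "ip2 (blinfun_apply A (s1 c x)) y = c * ip2 (blinfun_apply A x) y" for c x
      by (simp add: linear_op_scale[OF A] H2.ip_scale_left)
    ultimately show ?thesis using H1.Riesz_representation by metis
  qed
  then obtain g where g: "\<And>x y. ip2 (blinfun_apply A x) y = ip1 x (g y)" by metis
  have "bounded_linear g"
  proof (rule bounded_linear_intro[of _ "norm A"])
    show "g (x + y) = g x + g y" for x y
      by (rule H1.ip_eqI') (simp add: g[symmetric] H2.ip_add_right H1.ip_add_right)
    show "g (r *\<^sub>R x) = r *\<^sub>R g x" for r x
      by (rule H1.ip_eqI')
        (simp add: g[symmetric] H2.ip_scale_right H1.ip_scale_right
          H1.scale_of_real[symmetric] H2.scale_of_real[symmetric])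
    show "norm (g y) \<le> norm y * norm A" for y
    proof (cases "g y = 0")
      case False
      have "(norm (g y))\<^sup>2 = norm (ip1 (g y) (g y))" by (simp add: H1.ip_norm norm_power)
      also have "\<dots> = norm (ip2 (blinfun_apply A (g y)) y)" by (simp add: g)
      also have "\<dots> \<le> norm (blinfun_apply A (g y)) * norm y" by (rule H2.Cauchy_Schwarz)
      also have "\<dots> \<le> norm A * norm (g y) * norm y" by (intro mult_right_mono norm_blinfun) simp
      finally have "norm (g y) * norm (g y) \<le> norm (g y) * (norm y * norm A)"
        by (simp add: power2_eq_square mult_ac)
      with False show ?thesis by (subst (asm) mult_le_cancel_left_pos) auto
    qed simp
  qed
  then have "adj A = Blinfun g"
    by (intro adjoint_eqI) (simp add: g bounded_linear_Blinfun_apply)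
  with \<open>bounded_linear g\<close> show ?thesis by (simp add: g bounded_linear_Blinfun_apply)
qed

lemma adjoint_apply':
  assumes "linear_op A"
  shows "ip1 (blinfun_apply (adj A) y) x = ip2 y (blinfun_apply A x)"
  by (metis adjoint_apply[OF assms] H1.ip_commute H2.ip_commute)

end

text \<open>Exchanging the two spaces carries every result over to operators in the opposite
  direction, in particular to adjoints and Moore-Penrose inverses.\<close>

sublocale hilbert_pair \<subseteq> swap: hilbert_pair s2 ip2 s1 ip1 ..

context hilbert_pair
begin

lemma linear_adjoint:
  assumes A: "linear_op A"
  shows "swap.linear_op (adj A)"
  by (rule swap.linear_opI)
    (rule H1.ip_eqI', simp add: adjoint_apply[OF A, symmetric] H2.ip_scale_right H1.ip_scale_right)

text \<open>The map \<open>E k\<close> preserves the image under \<open>T k\<close> and is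
  annihilated by the other operators. Preimages chosen separately for each summand thus combine into
  one preimage under the sum.\<close>

lemma range_sum_orthogonal:
  assumes fin: "finite I" and lin: "\<And>k. k \<in> I \<Longrightarrow> linear_op (T k)"
    and orth: "\<And>k l x y. \<lbrakk>k \<in> I; l \<in> I; k \<noteq> l\<rbrakk> \<Longrightarrow>
      ip2 (blinfun_apply (T k) x) (blinfun_apply (T l) y) = 0"
    and E: "\<And>k x. k \<in> I \<Longrightarrow> blinfun_apply (T k) (E k x) = blinfun_apply (T k) x"
    and E0: "\<And>k l x. \<lbrakk>k \<in> I; l \<in> I; k \<noteq> l\<rbrakk> \<Longrightarrow> blinfun_apply (T l) (E k x) = 0"
  shows "is_orthogonal_sum s2 ip2 I (\<lambda>k. range_space (T k)) (range_space (\<Sum>k\<in>I. T k))"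
  unfolding is_orthogonal_sum_def
proof (intro conjI ballI impI)
  show "H2.subspace (range_space (T k))" if "k \<in> I" for k using range_subspace lin that by blast
  show "ip2 x y = 0" if "k \<in> I" "l \<in> I" "k \<noteq> l" "x \<in> range_space (T k)" "y \<in> range_space (T l)" for k l x y
    using orth that by (auto simp: range_space_def)
  show "range_space (\<Sum>k\<in>I. T k) = {\<Sum>k\<in>I. v k |v. \<forall>k\<in>I. v k \<in> range_space (T k)}"
  proof (intro equalityI subsetI)
    fix y assume "y \<in> range_space (\<Sum>k\<in>I. T k)"
    then obtain x where "y = (\<Sum>k\<in>I. blinfun_apply (T k) x)"
      by (auto simp: range_space_def blinfun.sum_left)
    then show "y \<in> {\<Sum>k\<in>I. v k |v. \<forall>k\<in>I. v k \<in> range_space (T k)}"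
      by (auto simp: range_space_def intro!: exI[of _ "\<lambda>k. blinfun_apply (T k) x"])
  next
    fix y assume "y \<in> {\<Sum>k\<in>I. v k |v. \<forall>k\<in>I. v k \<in> range_space (T k)}"
    then obtain v where y: "y = (\<Sum>k\<in>I. v k)" and "\<forall>k\<in>I. \<exists>x. v k = blinfun_apply (T k) x"
      unfolding range_space_def by blast
    then obtain x where x: "\<And>k. k \<in> I \<Longrightarrow> v k = blinfun_apply (T k) (x k)" by metis
    have "blinfun_apply (\<Sum>k\<in>I. T k) (\<Sum>k\<in>I. E k (x k)) = y"
      using E0 by (subst blinfun_sum_apply_sum[OF fin]) (simp_all add: y x E)
    then have "y = blinfun_apply (\<Sum>k\<in>I. T k) (\<Sum>k\<in>I. E k (x k))" ..
    then show "y \<in> range_space (\<Sum>k\<in>I. T k)" by (simp add: range_space_def)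
  qed
qed

text \<open>Pairing a vanishing sum with its term \<open>T l x\<close> leaves only
  \<open>ip2 (T l x) (T l x)\<close>, so each term is 0.\<close>

lemma null_space_sum:
  assumes fin: "finite I"
    and orth: "\<And>k l x y. \<lbrakk>k \<in> I; l \<in> I; k \<noteq> l\<rbrakk> \<Longrightarrow>
      ip2 (blinfun_apply (T k) x) (blinfun_apply (T l) y) = 0"
  shows "null_space (\<Sum>k\<in>I. T k) = (\<Inter>k\<in>I. null_space (T k))"
proof (intro equalityI subsetI INT_I)
  fix x l assume x: "x \<in> null_space (\<Sum>k\<in>I. T k)" and l: "l \<in> I"
  have "0 = ip2 (blinfun_apply (T l) x) (\<Sum>k\<in>I. blinfun_apply (T k) x)"
    using x by (simp add: null_space_def blinfun.sum_left)
  also have "\<dots> = (\<Sum>k\<in>I. if k = l then ip2 (blinfun_apply (T l) x) (blinfun_apply (T l) x) else 0)"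
    unfolding H2.ip_sum_right using orth l by (intro sum.cong) auto
  finally show "x \<in> null_space (T l)" using fin l by (simp add: null_space_def)
qed (simp add: null_space_def blinfun.sum_left)

section \<open>Moore-Penrose inverses: Penrose equations, uniqueness, existence, range and null
  space\<close>

lemma is_moore_penrose_iff:
  assumes A: "linear_op A"
  shows "is_moore_penrose s1 ip1 s2 ip2 A X \<longleftrightarrow> swap.linear_op X \<and>
    (\<forall>x. blinfun_apply A (blinfun_apply X (blinfun_apply A x)) = blinfun_apply A x) \<and>
    (\<forall>y. blinfun_apply X (blinfun_apply A (blinfun_apply X y)) = blinfun_apply X y) \<and>
    (\<forall>u v. ip2 (blinfun_apply A (blinfun_apply X u)) v = ip2 u (blinfun_apply A (blinfun_apply X v))) \<and>
    (\<forall>u v. ip1 (blinfun_apply X (blinfun_apply A u)) v = ip1 u (blinfun_apply X (blinfun_apply A v)))"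
    (is "?L \<longleftrightarrow> ?lin \<and> ?AXA \<and> ?XAX \<and> ?sa2 \<and> ?sa1")
proof -
  interpret H11: hilbert_pair s1 ip1 s1 ip1 ..
  interpret H22: hilbert_pair s2 ip2 s2 ip2 ..
  have AXA: "A o\<^sub>L X o\<^sub>L A = A \<longleftrightarrow> ?AXA" and XAX: "X o\<^sub>L A o\<^sub>L X = X \<longleftrightarrow> ?XAX"
    by (auto intro!: blinfun_eqI dest: arg_cong[where f=blinfun_apply] simp: fun_eq_iff)
  \<comment> \<open>The adjoint is a definite description: reading symmetry off it uses linearity of
    the product, by way of existence, while the converse is \<open>adjoint_eqI\<close>.\<close>
  have sa2: "hilbert_adjoint ip2 ip2 (A o\<^sub>L X) = A o\<^sub>L X \<longleftrightarrow> ?sa2" if ?lin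
  proof
    have "H22.linear_op (A o\<^sub>L X)"
      using that by (intro H22.linear_opI) (simp add: linear_op_scale[OF A] swap.linear_op_scale)
    then show "hilbert_adjoint ip2 ip2 (A o\<^sub>L X) = A o\<^sub>L X \<Longrightarrow> ?sa2"
      using H22.adjoint_apply[of "A o\<^sub>L X"] by simp
  qed (auto intro: H22.adjoint_eqI)
  have sa1: "hilbert_adjoint ip1 ip1 (X o\<^sub>L A) = X o\<^sub>L A \<longleftrightarrow> ?sa1" if ?lin
  proof
    have "H11.linear_op (X o\<^sub>L A)"
      using that by (intro H11.linear_opI) (simp add: linear_op_scale[OF A] swap.linear_op_scale)
    then show "hilbert_adjoint ip1 ip1 (X o\<^sub>L A) = X o\<^sub>L A \<Longrightarrow> ?sa1"
      using H11.adjoint_apply[of "X o\<^sub>L A"] by simp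
  qed (auto intro: H11.adjoint_eqI)
  \<comment> \<open>The equation \<open>X A X = X\<close> makes the range of \<open>X\<close> the
    fixed-point set of the continuous map \<open>X A\<close>.\<close>
  have closed: "closed (range_space X)" if ?XAX
  proof -
    have "range_space X = {x. blinfun_apply X (blinfun_apply A x) = x}"
      using that unfolding range_space_def by (auto simp: image_iff) metis
    also have "closed \<dots>" by (intro closed_Collect_eq continuous_intros)
    finally show ?thesis .
  qed
  show ?thesis
    unfolding is_moore_penrose_def BC_def AXA XAX using sa1 sa2 closed by blast
qed

lemma moore_penrose_unique:
  assumes A: "linear_op A"
    and X: "is_moore_penrose s1 ip1 s2 ip2 A X" and Y: "is_moore_penrose s1 ip1 s2 ip2 A Y"
  shows "X = Y"
proof (rule blinfun_eqI)
  fix w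
  note X = X[unfolded is_moore_penrose_iff[OF A]] and Y = Y[unfolded is_moore_penrose_iff[OF A]]
  \<comment> \<open>\<open>A X = (A Y) (A X)\<close>, and taking adjoints gives
    \<open>A X = (A X) (A Y) = A Y\<close>; likewise \<open>X A = Y A\<close>. Then
    \<open>X = X A X = Y A X = Y A Y = Y\<close>.\<close>
  have "blinfun_apply A (blinfun_apply X u) = blinfun_apply A (blinfun_apply Y u)" for u
    by (rule H2.ip_eqI) (metis X Y)
  moreover have "blinfun_apply X (blinfun_apply A u) = blinfun_apply Y (blinfun_apply A u)" for u
    by (rule H1.ip_eqI) (metis X Y)
  ultimately show "blinfun_apply X w = blinfun_apply Y w" by (metis X Y)
qed

lemma moore_penrose_eqI:
  assumes A: "linear_op A" and X: "is_moore_penrose s1 ip1 s2 ip2 A X"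
  shows "moore_penrose s1 ip1 s2 ip2 A = X"
  unfolding moore_penrose_def using X moore_penrose_unique[OF A] by blast

text \<open>The functionals \<open>\<langle>\<cdot>, y\<rangle>\<close> with \<open>y\<close> in the range and \<open>\<parallel>A\<^sup>* y\<parallel> \<le> 1\<close> are bounded pointwise:
  by \<open>\<parallel>x\<parallel>\<close> at \<open>A x\<close>, and by \<open>0\<close> on the orthogonal complement of the range.\<close>

lemma adjoint_bounded_below:
  assumes A: "linear_op A" and cl: "closed (range_space A)"
  obtains c where "c > 0"
    "\<And>y. y \<in> range_space A \<Longrightarrow> norm y \<le> c * norm (blinfun_apply (adj A) y)"
proof -
  let ?Y = "{y \<in> range_space A. norm (blinfun_apply (adj A) y) \<le> 1}"
  let ?f = "\<lambda>y. Blinfun (\<lambda>u. ip2 u y)"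
  have f: "blinfun_apply (?f y) u = ip2 u y" for y u
    by (simp add: bounded_linear_Blinfun_apply H2.bounded_linear_ip_left)
  have sub: "H2.subspace (range_space A)" by (rule range_subspace[OF A])
  have "\<exists>M. \<forall>T\<in>?f ` ?Y. norm (blinfun_apply T u) \<le> M" for u
  proof -
    obtain p where "p \<in> range_space A" and p: "\<And>y. y \<in> range_space A \<Longrightarrow> ip2 (u - p) y = 0"
      using H2.orthogonal_decomposition[OF sub cl, of u] by blast
    then obtain x where x: "p = blinfun_apply A x" by (auto simp: range_space_def)
    have "norm (ip2 u y) \<le> norm x" if "y \<in> ?Y" for y
    proof -
      have "ip2 u y = ip2 p y" using p[of y] that by (simp add: H2.ip_diff_left)
      also have "\<dots> = ip1 x (blinfun_apply (adj A) y)" by (simp add: x adjoint_apply[OF A])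
      finally have "norm (ip2 u y) \<le> norm x * norm (blinfun_apply (adj A) y)"
        by (simp add: H1.Cauchy_Schwarz)
      also have "\<dots> \<le> norm x * 1" using that by (intro mult_left_mono) auto
      finally show ?thesis by simp
    qed
    then show ?thesis by (intro exI[of _ "norm x"]) (auto simp: f)
  qed
  from uniform_boundedness[OF this] obtain M where M: "M \<ge> 0" "\<And>y. y \<in> ?Y \<Longrightarrow> norm (?f y) \<le> M"
    by blast
  \<comment> \<open>Evaluating the functional at \<open>y\<close> itself bounds
    \<open>norm y\<close> by its operator norm.\<close>
  have Y: "norm y \<le> M" if "y \<in> ?Y" for y
  proof (cases "y = 0")
    case False
    have "norm y * norm y = norm (blinfun_apply (?f y) y)"
      by (simp add: f H2.ip_norm norm_power power2_eq_square norm_mult)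
    also have "\<dots> \<le> norm (?f y) * norm y" by (rule norm_blinfun)
    also have "\<dots> \<le> M * norm y" using M(2)[OF that] by (rule mult_right_mono) simp
    finally show ?thesis using False by simp
  qed (use M in simp)
  \<comment> \<open>Rescale \<open>y\<close> into \<open>?Y\<close>; \<open>M + 1\<close> in place
    of \<open>M\<close> makes the constant positive. If \<open>adj A\<close> kills \<open>y\<close>,
    then \<open>y\<close> is orthogonal to the range containing it.\<close>
  have "norm y \<le> (M + 1) * norm (blinfun_apply (adj A) y)" if y: "y \<in> range_space A" for y
  proof (cases "blinfun_apply (adj A) y = 0")
    case True
    obtain x where "y = blinfun_apply A x" using y by (auto simp: range_space_def)
    then have "ip2 y y = 0" using adjoint_apply[OF A, of x y] True by simp
    then show ?thesis by simp
  next
    case False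
    let ?n = "norm (blinfun_apply (adj A) y)"
    have "(1 / ?n) *\<^sub>R y \<in> ?Y"
      using False H2.subspace_scaleR[OF sub y] by (simp add: blinfun.scaleR_right)
    from Y[OF this] have "norm y \<le> M * ?n" using False by (simp add: field_simps)
    also have "\<dots> \<le> (M + 1) * ?n" by (intro mult_right_mono) auto
    finally show ?thesis .
  qed
  with M(1) show ?thesis by (intro that[of "M + 1"]) auto
qed

text \<open>Project \<open>y\<close> onto the range of \<open>A\<close>; the error is orthogonal to
  that range, hence killed by \<open>adj A\<close>. Every value of \<open>adj A\<close> is thus
  attained where \<open>adj A\<close> is bounded below.\<close>

lemma adjoint_in_adjoint_range:
  assumes A: "linear_op A" and cl: "closed (range_space A)"
  obtains w where "w \<in> range_space A" "blinfun_apply (adj A) w = blinfun_apply (adj A) y"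
proof -
  obtain p where p: "p \<in> range_space A" "\<And>z. z \<in> range_space A \<Longrightarrow> ip2 (y - p) z = 0"
    using H2.orthogonal_decomposition[OF range_subspace[OF A] cl, of y] by blast
  have "blinfun_apply (adj A) (y - p) = 0"
    by (rule H1.ip_eqI) (simp add: adjoint_apply'[OF A] p range_space_def)
  with p(1) show ?thesis by (intro that[of p]) (auto simp: blinfun.diff_right)
qed

text \<open>A map bounded below on the complete space \<open>range_space A\<close> has a complete
  image there, and by \<open>adjoint_in_adjoint_range\<close> this image is the full range of
  \<open>adj A\<close>.\<close>

lemma closed_range_adjoint:
  assumes A: "linear_op A" and cl: "closed (range_space A)"
  shows "closed (range_space (adj A))"
proof -
  obtain c where c: "c > 0"
    "\<And>y. y \<in> range_space A \<Longrightarrow> norm y \<le> c * norm (blinfun_apply (adj A) y)"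
    using adjoint_bounded_below[OF assms] by blast
  have "complete (blinfun_apply (adj A) ` range_space A)"
  proof (rule complete_isometric_image[of "1 / c"])
    show "Real_Vector_Spaces.subspace (range_space A)"
      using range_subspace[OF A] H2.subspace_scaleR[OF range_subspace[OF A]]
      by (auto simp: Real_Vector_Spaces.subspace_def H2.subspace_0 H2.subspace_add)
  qed (use c cl in \<open>auto simp: field_simps blinfun.bounded_linear_right complete_eq_closed\<close>)
  moreover have "blinfun_apply (adj A) ` range_space A = range_space (adj A)"
  proof -
    have "blinfun_apply (adj A) y \<in> blinfun_apply (adj A) ` range_space A" for y
      using adjoint_in_adjoint_range[OF assms, of y] by (metis imageI)
    then show ?thesis by (auto simp: range_space_def)
  qed
  ultimately show ?thesis by (simp add: complete_eq_closed)
qed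

text \<open>Write \<open>x = adj A w\<close> with \<open>w\<close> in the range of \<open>A\<close>.
  Then \<open>ip1 x x = ip2 w (A x)\<close>, and \<open>norm w\<close> is at most
  \<open>c * norm x\<close>, so the constant of \<open>adjoint_bounded_below\<close> serves
  again.\<close>

lemma bounded_below:
  assumes A: "linear_op A" and cl: "closed (range_space A)"
  obtains c where "c > 0"
    "\<And>x. x \<in> range_space (adj A) \<Longrightarrow> norm x \<le> c * norm (blinfun_apply A x)"
proof -
  obtain c where c: "c > 0"
    "\<And>y. y \<in> range_space A \<Longrightarrow> norm y \<le> c * norm (blinfun_apply (adj A) y)"
    using adjoint_bounded_below[OF assms] by blast
  have "norm x \<le> c * norm (blinfun_apply A x)" if x: "x \<in> range_space (adj A)" for x
  proof (cases "x = 0")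
    case False
    obtain w where w: "w \<in> range_space A" "x = blinfun_apply (adj A) w"
      using x adjoint_in_adjoint_range[OF assms] unfolding range_space_def by (metis imageE)
    have "norm x * norm x = norm (ip1 x x)"
      by (simp add: H1.ip_norm norm_power power2_eq_square norm_mult)
    also have "ip1 x x = ip2 w (blinfun_apply A x)" using adjoint_apply'[OF A, of w x] w by simp
    also have "norm \<dots> \<le> norm w * norm (blinfun_apply A x)" by (rule H2.Cauchy_Schwarz)
    also have "\<dots> \<le> c * norm x * norm (blinfun_apply A x)"
      using c(2)[OF w(1)] w(2) by (intro mult_right_mono) auto
    finally have "norm x * norm x \<le> norm x * (c * norm (blinfun_apply A x))" by (simp add: mult_ac)
    with False show ?thesis by (subst (asm) mult_le_cancel_left_pos) auto
  qed simp
  with c(1) show ?thesis by (rule that)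
qed

lemma adjoint_self_eq_0:
  assumes A: "linear_op A" and "blinfun_apply (adj A) (blinfun_apply A x) = 0"
  shows "blinfun_apply A x = 0"
  using adjoint_apply[OF A, of x "blinfun_apply A x"] assms(2) by simp

text \<open>\<open>A\<^sup>\<dagger> y\<close> is the solution of the normal equations \<open>A\<^sup>* A x = A\<^sup>* y\<close> that lies in the range
  of \<open>A\<^sup>*\<close>.\<close>

theorem moore_penrose_exists:
  assumes A: "linear_op A" and cl: "closed (range_space A)"
  shows "\<exists>X. is_moore_penrose s1 ip1 s2 ip2 A X"
proof -
  define sol where "sol y x \<longleftrightarrow> x \<in> range_space (adj A) \<and>
    blinfun_apply (adj A) (blinfun_apply A x) = blinfun_apply (adj A) y" for x y
  have sub: "H1.subspace (range_space (adj A))" by (rule swap.range_subspace[OF linear_adjoint[OF A]])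
  have cl': "closed (range_space (adj A))" by (rule closed_range_adjoint[OF assms])
  obtain c where c: "c > 0"
    "\<And>x. x \<in> range_space (adj A) \<Longrightarrow> norm x \<le> c * norm (blinfun_apply A x)"
    using bounded_below[OF assms] by blast
  \<comment> \<open>Replace \<open>y\<close> by a vector \<open>A x\<close> with the same image
    under \<open>adj A\<close>, then \<open>x\<close> by its projection \<open>p\<close> onto the
    range of \<open>adj A\<close>; the error \<open>x - p\<close> lies in the null space of
    \<open>A\<close>.\<close>
  have ex: "\<exists>x. sol y x" for y
  proof -
    obtain w where "w \<in> range_space A" and w: "blinfun_apply (adj A) w = blinfun_apply (adj A) y"
      using adjoint_in_adjoint_range[OF assms] by blast
    then obtain x where x: "w = blinfun_apply A x" by (auto simp: range_space_def)
    obtain p where p: "p \<in> range_space (adj A)" "\<And>z. z \<in> range_space (adj A) \<Longrightarrow> ip1 (x - p) z = 0"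
      using H1.orthogonal_decomposition[OF sub cl', of x] by blast
    have "blinfun_apply A (x - p) = 0"
      by (rule H2.ip_eqI) (simp add: adjoint_apply[OF A] p range_space_def)
    then have "sol y p" using p(1) w x by (simp add: sol_def blinfun.diff_right)
    then show ?thesis ..
  qed
  have uniq: "x = x'" if "sol y x" "sol y x'" for y x x'
  proof -
    have "blinfun_apply (adj A) (blinfun_apply A (x - x')) = 0"
      using that by (simp add: sol_def blinfun.diff_right)
    then have "blinfun_apply A (x - x') = 0" by (rule adjoint_self_eq_0[OF A])
    moreover have "x - x' \<in> range_space (adj A)" using that sub by (simp add: sol_def H1.subspace_diff)
    ultimately show ?thesis using c(2)[of "x - x'"] by simp
  qed
  obtain g where g: "\<And>y. sol y (g y)" using ex by metis
  have g_eq: "g y = x" if "sol y x" for x y using uniq g that by blast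
  have AAg: "blinfun_apply (adj A) (blinfun_apply A (g y)) = blinfun_apply (adj A) y"
    and g_range: "g y \<in> range_space (adj A)" for y using g by (auto simp: sol_def)
  have g_scale: "g (s2 k y) = s1 k (g y)" for k y
    by (rule g_eq) (simp add: sol_def AAg g_range sub H1.subspace_scale linear_op_scale[OF A]
        swap.linear_op_scale[OF linear_adjoint[OF A]])
  have "bounded_linear g"
  proof (rule bounded_linear_intro[of _ c])
    show "g (x + y) = g x + g y" for x y
      by (rule g_eq) (simp add: sol_def AAg g_range sub H1.subspace_add blinfun.add_right)
    show "g (r *\<^sub>R x) = r *\<^sub>R g x" for r x
      by (simp add: g_scale flip: H1.scale_of_real H2.scale_of_real)
    show "norm (g y) \<le> norm y * c" for y
    proof -
      let ?z = "blinfun_apply A (g y)"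
      \<comment> \<open>\<open>?z\<close> is the orthogonal projection of \<open>y\<close> onto the
        range of \<open>A\<close>, so its norm does not exceed that of \<open>y\<close>.\<close>
      have "norm ?z \<le> norm y"
      proof (cases "?z = 0")
        case False
        have "ip2 ?z ?z = ip2 ?z y" by (simp add: adjoint_apply[OF A] AAg)
        then have "norm ?z * norm ?z = norm (ip2 ?z y)"
          by (simp add: H2.ip_norm norm_power power2_eq_square norm_mult flip: \<open>ip2 ?z ?z = ip2 ?z y\<close>)
        also have "\<dots> \<le> norm ?z * norm y" by (rule H2.Cauchy_Schwarz)
        finally show ?thesis using False by simp
      qed simp
      then show ?thesis
        using c(1) order_trans[OF c(2)[OF g_range[of y]] mult_left_mono[of "norm ?z" "norm y" c]]
        by (simp add: mult.commute)
    qed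
  qed
  then have X: "blinfun_apply (Blinfun g) = g" by (rule bounded_linear_Blinfun_apply)
  have AgA: "blinfun_apply A (g (blinfun_apply A x)) = blinfun_apply A x" for x
    using adjoint_self_eq_0[OF A, of "g (blinfun_apply A x) - x"] by (simp add: blinfun.diff_right AAg)
  have "is_moore_penrose s1 ip1 s2 ip2 A (Blinfun g)"
    unfolding is_moore_penrose_iff[OF A] X
  proof (intro conjI allI)
    show "Vector_Spaces.linear s2 s1 g"
      using swap.linear_opI[of "Blinfun g"] by (simp add: X g_scale)
    show "blinfun_apply A (g (blinfun_apply A x)) = blinfun_apply A x" for x by (rule AgA)
    show "g (blinfun_apply A (g y)) = g y" for y
      by (rule g_eq) (simp add: sol_def g_range)
    show "ip2 (blinfun_apply A (g u)) v = ip2 u (blinfun_apply A (g v))" for u v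
      by (metis adjoint_apply[OF A] adjoint_apply'[OF A] AAg)
    \<comment> \<open>Since \<open>g u\<close> lies in the range of \<open>adj A\<close>, moving
      \<open>adj A\<close> across turns the claim into \<open>A g A = A\<close>. Conjugating then
      yields the symmetry of \<open>g A\<close>.\<close>
    have "ip1 (g u) (g (blinfun_apply A v)) = ip1 (g u) v" for u v
    proof -
      obtain w where w: "g u = blinfun_apply (adj A) w" using g_range[of u] by (auto simp: range_space_def)
      show ?thesis by (simp add: w adjoint_apply'[OF A] AgA)
    qed
    then show "ip1 (g (blinfun_apply A u)) v = ip1 u (g (blinfun_apply A v))" for u v
      by (metis H1.ip_commute)
  qed
  then show ?thesis ..
qed

lemma is_moore_penrose_moore_penrose:
  assumes "A \<in> BC s1 s2"
  shows "is_moore_penrose s1 ip1 s2 ip2 A (moore_penrose s1 ip1 s2 ip2 A)"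
  using assms moore_penrose_exists[of A] moore_penrose_eqI[of A] by (auto simp: BC_def)

text \<open>Self-adjointness of \<open>X A\<close> gives \<open>X A = adj A (swap.adj X)\<close>,
  and \<open>X y = X A (X y)\<close>.\<close>

lemma moore_penrose_range:
  assumes A: "linear_op A" and X: "is_moore_penrose s1 ip1 s2 ip2 A X"
  shows "blinfun_apply X y \<in> range_space (adj A)"
proof -
  note X = X[unfolded is_moore_penrose_iff[OF A]]
  have "blinfun_apply X (blinfun_apply A x) = blinfun_apply (adj A) (blinfun_apply (swap.adj X) x)" for x
  proof (rule H1.ip_eqI)
    fix v
    have "ip1 (blinfun_apply X (blinfun_apply A x)) v = ip1 x (blinfun_apply X (blinfun_apply A v))"
      using X by blast
    also have "\<dots> = ip2 (blinfun_apply (swap.adj X) x) (blinfun_apply A v)"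
      using swap.adjoint_apply'[of X] X by simp
    finally show "ip1 (blinfun_apply X (blinfun_apply A x)) v
        = ip1 (blinfun_apply (adj A) (blinfun_apply (swap.adj X) x)) v"
      by (simp add: adjoint_apply'[OF A])
  qed
  then show ?thesis unfolding range_space_def by (metis X rangeI)
qed

text \<open>Self-adjointness of \<open>A X\<close> gives
  \<open>ip2 (A (X y)) v = ip1 (adj A y) (X v) = 0\<close>, and \<open>X = X A X\<close>.\<close>

lemma moore_penrose_eq_0:
  assumes A: "linear_op A" and X: "is_moore_penrose s1 ip1 s2 ip2 A X"
    and y: "blinfun_apply (adj A) y = 0"
  shows "blinfun_apply X y = 0"
proof -
  note X = X[unfolded is_moore_penrose_iff[OF A]]
  have "blinfun_apply A (blinfun_apply X y) = 0"
  proof (rule H2.ip_eqI)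
    fix v
    have "ip2 (blinfun_apply A (blinfun_apply X y)) v = ip2 y (blinfun_apply A (blinfun_apply X v))"
      using X by blast
    also have "\<dots> = 0" by (simp add: adjoint_apply'[OF A, symmetric] y)
    finally show "ip2 (blinfun_apply A (blinfun_apply X y)) v = ip2 0 v" by simp
  qed
  then show ?thesis using X by (metis blinfun.zero_right)
qed

lemma adjoint_moore_penrose:
  assumes A: "linear_op A" and X: "is_moore_penrose s1 ip1 s2 ip2 A X"
  shows "blinfun_apply (adj A) (blinfun_apply A (blinfun_apply X y)) = blinfun_apply (adj A) y"
  using X unfolding is_moore_penrose_iff[OF A]
  by (intro H1.ip_eqI) (simp add: adjoint_apply'[OF A])

end

section \<open>Sums of operators with mutually orthogonal ranges and mutually orthogonal adjoint
  ranges\<close>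

theorem theorem2p1:
  fixes s1 :: "'k::real_or_complex \<Rightarrow> 'a::banach \<Rightarrow> 'a" and ip1 :: "'a \<Rightarrow> 'a \<Rightarrow> 'k"
    and s2 :: "'k \<Rightarrow> 'b::banach \<Rightarrow> 'b" and ip2 :: "'b \<Rightarrow> 'b \<Rightarrow> 'k"
    and K :: nat and A :: "nat \<Rightarrow> 'a \<Rightarrow>\<^sub>L 'b"
  assumes "hilbert_space s1 ip1" and "hilbert_space s2 ip2"
    and "K \<ge> 1"
    and "\<forall>k\<in>{1..K}. A k \<in> BC s1 s2"
    and "\<forall>k\<in>{1..K}. \<forall>k'\<in>{1..K}. k \<noteq> k' \<longrightarrow>
           range_space (A k) \<subseteq> null_space (hilbert_adjoint ip1 ip2 (A k')) \<and>
           range_space (hilbert_adjoint ip1 ip2 (A k)) \<subseteq> null_space (A k')"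
  shows
    "(\<forall>k\<in>{1..K}. \<forall>k'\<in>{1..K}. k \<noteq> k' \<longrightarrow>
        A k o\<^sub>L moore_penrose s1 ip1 s2 ip2 (A k') = 0 \<and>
        moore_penrose s1 ip1 s2 ip2 (A k) o\<^sub>L A k' = 0)
     \<and>
     (is_orthogonal_sum s2 ip2 {1..K} (\<lambda>k. range_space (A k)) (range_space (\<Sum>k=1..K. A k)) \<and>
      is_orthogonal_sum s1 ip1 {1..K} (\<lambda>k. range_space (hilbert_adjoint ip1 ip2 (A k)))
        (range_space (\<Sum>k=1..K. hilbert_adjoint ip1 ip2 (A k))))
     \<and>
     (null_space (\<Sum>k=1..K. A k) = (\<Inter>k\<in>{1..K}. null_space (A k)) \<and>
      null_space (\<Sum>k=1..K. hilbert_adjoint ip1 ip2 (A k))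
        = (\<Inter>k\<in>{1..K}. null_space (hilbert_adjoint ip1 ip2 (A k))))
     \<and>
     ((\<exists>!X. is_moore_penrose s1 ip1 s2 ip2 (\<Sum>k=1..K. A k) X) \<and>
      moore_penrose s1 ip1 s2 ip2 (\<Sum>k=1..K. A k) = (\<Sum>k=1..K. moore_penrose s1 ip1 s2 ip2 (A k)))"
proof -
  interpret hilbert_pair s1 ip1 s2 ip2
    by (intro hilbert_pair.intro assms)
  let ?I = "{1..K}"
  define X where "X k = moore_penrose s1 ip1 s2 ip2 (A k)" for k
  have lin: "linear_op (A k)" if "k \<in> ?I" for k using assms(4) that by (simp add: BC_def)
  have mp: "is_moore_penrose s1 ip1 s2 ip2 (A k) (X k)" if "k \<in> ?I" for k
    unfolding X_def using assms(4) that by (intro is_moore_penrose_moore_penrose) blast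
  have mpD: "swap.linear_op (X k)"
    "blinfun_apply (A k) (blinfun_apply (X k) (blinfun_apply (A k) x)) = blinfun_apply (A k) x"
    "blinfun_apply (X k) (blinfun_apply (A k) (blinfun_apply (X k) y)) = blinfun_apply (X k) y"
    "ip2 (blinfun_apply (A k) (blinfun_apply (X k) y)) v = ip2 y (blinfun_apply (A k) (blinfun_apply (X k) v))"
    "ip1 (blinfun_apply (X k) (blinfun_apply (A k) x)) u = ip1 x (blinfun_apply (X k) (blinfun_apply (A k) u))"
    if "k \<in> ?I" for k x u y v
    using mp[OF that] is_moore_penrose_iff[OF lin[OF that]] by blast+
  have adjA: "blinfun_apply (adj (A l)) (blinfun_apply (A k) x) = 0"
    and Aadj: "blinfun_apply (A l) (blinfun_apply (adj (A k)) y) = 0"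
    if "k \<in> ?I" "l \<in> ?I" "k \<noteq> l" for k l x y
    using assms(5) that unfolding range_space_def null_space_def by blast+
  \<comment> \<open>The range of \<open>X k\<close> lies in that of \<open>adj (A k)\<close>, hence
    in the null space of \<open>A l\<close>.\<close>
  have AX: "blinfun_apply (A l) (blinfun_apply (X k) y) = 0"
    if "k \<in> ?I" "l \<in> ?I" "k \<noteq> l" for k l y
    using moore_penrose_range[OF lin mp, of k y] Aadj that by (auto simp: range_space_def)
  \<comment> \<open>The range of \<open>A k\<close> lies in the null space of
    \<open>adj (A l)\<close>, hence in that of \<open>X l\<close>.\<close>
  have XA: "blinfun_apply (X l) (blinfun_apply (A k) x) = 0"
    if "k \<in> ?I" "l \<in> ?I" "k \<noteq> l" for k l x
    using moore_penrose_eq_0[OF lin mp] adjA that by blast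
  have orth2: "ip2 (blinfun_apply (A k) x) (blinfun_apply (A l) y) = 0"
    if "k \<in> ?I" "l \<in> ?I" "k \<noteq> l" for k l x y
    using that by (simp add: adjoint_apply lin adjA)
  have orth1: "ip1 (blinfun_apply (adj (A k)) x) (blinfun_apply (adj (A l)) y) = 0"
    if "k \<in> ?I" "l \<in> ?I" "k \<noteq> l" for k l x y
    using that by (simp add: adjoint_apply' lin Aadj)
  let ?A = "\<Sum>k\<in>?I. A k" and ?X = "\<Sum>k\<in>?I. X k"
  have linA: "linear_op ?A" using lin by (rule linear_op_sum)
  have AX_sum: "blinfun_apply ?A (blinfun_apply ?X y)
      = (\<Sum>k\<in>?I. blinfun_apply (A k) (blinfun_apply (X k) y))" for y
    unfolding blinfun.sum_left[of X] by (rule blinfun_sum_apply_sum) (use AX in auto)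
  have XA_sum: "blinfun_apply ?X (blinfun_apply ?A x)
      = (\<Sum>k\<in>?I. blinfun_apply (X k) (blinfun_apply (A k) x))" for x
    unfolding blinfun.sum_left[of A] by (rule blinfun_sum_apply_sum) (use XA in auto)
  have mp_sum: "is_moore_penrose s1 ip1 s2 ip2 ?A ?X"
    unfolding is_moore_penrose_iff[OF linA]
  proof (intro conjI allI)
    show "swap.linear_op ?X" using mpD by (intro swap.linear_op_sum) blast
    \<comment> \<open>After \<open>XA_sum\<close>, the outer sum meets the vectors
      \<open>X k (A k x)\<close>; the mixed terms vanish by \<open>AX\<close>, leaving
      \<open>A k X k A k = A k\<close>.\<close>
    show "blinfun_apply ?A (blinfun_apply ?X (blinfun_apply ?A x)) = blinfun_apply ?A x" for x
      unfolding XA_sum using AX mpD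
      by (subst blinfun_sum_apply_sum) (auto simp: blinfun.sum_left intro!: sum.cong)
    show "blinfun_apply ?X (blinfun_apply ?A (blinfun_apply ?X y)) = blinfun_apply ?X y" for y
      unfolding AX_sum using XA mpD
      by (subst blinfun_sum_apply_sum) (auto simp: blinfun.sum_left intro!: sum.cong)
    show "ip2 (blinfun_apply ?A (blinfun_apply ?X u)) v = ip2 u (blinfun_apply ?A (blinfun_apply ?X v))" for u v
      unfolding AX_sum H2.ip_sum_left H2.ip_sum_right using mpD by (intro sum.cong) auto
    show "ip1 (blinfun_apply ?X (blinfun_apply ?A u)) v = ip1 u (blinfun_apply ?X (blinfun_apply ?A v))" for u v
      unfolding XA_sum H1.ip_sum_left H1.ip_sum_right using mpD by (intro sum.cong) auto
  qed
  show ?thesis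
  proof (intro conjI ballI impI)
    show "A k o\<^sub>L moore_penrose s1 ip1 s2 ip2 (A k') = 0"
      and "moore_penrose s1 ip1 s2 ip2 (A k) o\<^sub>L A k' = 0"
      if "k \<in> ?I" "k' \<in> ?I" "k \<noteq> k'" for k k'
      using AX XA that by (auto intro!: blinfun_eqI simp flip: X_def)
    show "is_orthogonal_sum s2 ip2 ?I (\<lambda>k. range_space (A k)) (range_space ?A)"
      \<comment> \<open>The witness \<open>X k A k\<close> satisfies
        \<open>A k X k A k = A k\<close>, and \<open>A l X k = 0\<close> for other indices.\<close>
      by (rule range_sum_orthogonal[where E = "\<lambda>k x. blinfun_apply (X k) (blinfun_apply (A k) x)"])
        (use lin orth2 mpD AX in auto)
    show "is_orthogonal_sum s1 ip1 ?I (\<lambda>k. range_space (adj (A k))) (range_space (\<Sum>k\<in>?I. adj (A k)))"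
      \<comment> \<open>For adjoints the witness is \<open>A k X k\<close>:
        \<open>adj (A k) A k X k = adj (A k)\<close>, and \<open>adj (A l) A k = 0\<close> for other
        indices.\<close>
      by (rule swap.range_sum_orthogonal[where E = "\<lambda>k y. blinfun_apply (A k) (blinfun_apply (X k) y)"])
        (use linear_adjoint lin orth1 adjoint_moore_penrose[OF lin mp] adjA in auto)
    show "null_space ?A = (\<Inter>k\<in>?I. null_space (A k))"
      by (rule null_space_sum) (use orth2 in auto)
    show "null_space (\<Sum>k\<in>?I. adj (A k)) = (\<Inter>k\<in>?I. null_space (adj (A k)))"
      by (rule swap.null_space_sum) (use orth1 in auto)
    show "\<exists>!Y. is_moore_penrose s1 ip1 s2 ip2 ?A Y"
      using mp_sum moore_penrose_unique[OF linA] by blast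
    show "moore_penrose s1 ip1 s2 ip2 ?A = (\<Sum>k\<in>?I. moore_penrose s1 ip1 s2 ip2 (A k))"
      using moore_penrose_eqI[OF linA mp_sum] by (simp add: X_def)
  qed
qed

end
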